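(* Let $A$ and $B$ be $K$-quasiconvex subgroups of a finitely generated group $G$. Let $M_A$ be the number of vertices in $N_K(A\cdot 1)\subset \mathrm{Cayley}(G,A)$ and let $M_B$ be the number of vertices in $N_K(B\cdot 1)\subset \mathrm{Cayley}(G,B)$. Then the intersection $A\cap B$ is $K_0$-quasiconvex in $G$ with $K_0=M_A\cdot M_B$.
   Context: $G$ is generated by a fixed finite set $X^*=\{x,x^{-1}\mid x\in X\}$, and $\mathrm{Cayley}(G)$ is the Cayley graph of $G$ with respect to $X^*$, with vertices $G$ and edges from $g$ to $gx$ ($x\in X^*$), each of length $1$. A subgroup $H$ of $G$ is $K$-quasiconvex if every geodesic in $\mathrm{Cayley}(G)$ with both endpoints in $H$ is contained in the closed $K$-neighborhood of $H$. For a subgroup $H$ of $G$, the coset graph $\mathrm{Cayley}(G,H)$ has as vertices the cosets $Hg$, $g\in G$, and an edge $(Hg,x)$ from $Hg$ to $Hgx$ for each coset $Hg$ and each $x\in X^*$, with the path metric in which each edge has length $1$; $N_R(H\cdot 1)$ is the closed $R$-neighborhood of the base vertex $H\cdot 1$. *)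

theory Defs
  imports "HOL-Algebra.Generated_Groups" "Graph_Theory.Shortest_Path"
begin

definition sym_gens :: "('a, 'm) monoid_scheme \<Rightarrow> 'a set \<Rightarrow> 'a set" where
  "sym_gens G X = X \<union> m_inv G ` X"

definition cayley_graph ::
  "('a, 'm) monoid_scheme \<Rightarrow> 'a set \<Rightarrow> ('a, 'a \<times> 'a) pre_digraph" where
  "cayley_graph G X =
    \<lparr>verts = carrier G,
     arcs = carrier G \<times> sym_gens G X,
     tail = fst,
     head = (\<lambda>(g, x). g \<otimes>\<^bsub>G\<^esub> x)\<rparr>"

definition coset_graph ::
  "('a, 'm) monoid_scheme \<Rightarrow> 'a set \<Rightarrow> 'a set \<Rightarrow> ('a set, 'a set \<times> 'a) pre_digraph" where
  "coset_graph G X H =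
    \<lparr>verts = rcosets\<^bsub>G\<^esub> H,
     arcs = (rcosets\<^bsub>G\<^esub> H) \<times> sym_gens G X,
     tail = fst,
     head = (\<lambda>(C, x). C #>\<^bsub>G\<^esub> x)\<rparr>"

text \<open>
  In the two graphs above every arc \<open>(v, x)\<close> has the reverse arc \<open>(vx, x\<inverse>)\<close>, so the distance
  computed with directed walks is the path metric of the underlying undirected graph.
\<close>

context wf_digraph
begin

definition path_dist :: "'a \<Rightarrow> 'a \<Rightarrow> ereal" where
  "path_dist u v = \<mu> (\<lambda>_. 1) u v"

definition geodesic :: "'a \<Rightarrow> 'b awalk \<Rightarrow> 'a \<Rightarrow> bool" where
  "geodesic u p v \<longleftrightarrow> awalk u p v \<and> ereal (awalk_cost (\<lambda>_. 1) p) = path_dist u v"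

definition nbhd_verts :: "real \<Rightarrow> 'a set \<Rightarrow> 'a set" where
  "nbhd_verts R S = {v \<in> verts G. \<exists>s\<in>S. path_dist s v \<le> ereal R}"

text \<open>
  The point of the metric graph at distance \<open>t\<close> from the tail of the arc \<open>a\<close>, where
  \<open>0 \<le> t \<le> 1\<close>, is encoded by the pair \<open>(a, t)\<close>. A path from a vertex \<open>s\<close> to it reaches it
  through one of the two ends of \<open>a\<close>.
\<close>

definition point_dist :: "'a \<Rightarrow> 'b \<times> real \<Rightarrow> ereal" where
  "point_dist s = (\<lambda>(a, t).
     min (path_dist s (tail G a) + ereal t) (path_dist s (head G a) + ereal (1 - t)))"

definition nbhd_points :: "real \<Rightarrow> 'a set \<Rightarrow> ('b \<times> real) set" where
  "nbhd_points R S = {(a, t). a \<in> arcs G \<and> t \<in> {0..1} \<and> (\<exists>s\<in>S. point_dist s (a, t) \<le> ereal R)}"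

text \<open>
  A walk, as a subset of the metric graph, consists of its vertices and of all points of its
  arcs. Distances to a nonempty set of vertices are attained, because at a fixed
  parameter \<open>t\<close> they take values in a discrete set.
\<close>

definition walk_in_nbhd :: "real \<Rightarrow> 'a set \<Rightarrow> 'a \<Rightarrow> 'b awalk \<Rightarrow> bool" where
  "walk_in_nbhd R S u p \<longleftrightarrow>
     set (awalk_verts u p) \<subseteq> nbhd_verts R S \<and> set p \<times> {0..1} \<subseteq> nbhd_points R S"

end

definition quasiconvex ::
  "('a, 'm) monoid_scheme \<Rightarrow> 'a set \<Rightarrow> real \<Rightarrow> 'a set \<Rightarrow> bool" where
  "quasiconvex G X K H \<longleftrightarrow>
     subgroup H G \<and>
     (\<forall>u\<in>H. \<forall>v\<in>H. \<forall>p. wf_digraph.geodesic (cayley_graph G X) u p v \<longrightarrow>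
        wf_digraph.walk_in_nbhd (cayley_graph G X) K H u p)"

definition num_coset_nbhd ::
  "('a, 'm) monoid_scheme \<Rightarrow> 'a set \<Rightarrow> real \<Rightarrow> 'a set \<Rightarrow> nat" where
  "num_coset_nbhd G X R H =
     card (wf_digraph.nbhd_verts (coset_graph G X H) R {H #>\<^bsub>G\<^esub> \<one>\<^bsub>G\<^esub>})"

lemma (in group) sym_gens_closed:
  assumes "X \<subseteq> carrier G"
  shows "sym_gens G X \<subseteq> carrier G"
  using assms by (auto simp: sym_gens_def)

lemma (in group) wf_cayley_graph:
  assumes "X \<subseteq> carrier G"
  shows "wf_digraph (cayley_graph G X)"
  using sym_gens_closed[OF assms] by (unfold_locales) (auto simp: cayley_graph_def)

lemma (in group) wf_coset_graph:
  assumes "X \<subseteq> carrier G" and "subgroup H G"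
  shows "wf_digraph (coset_graph G X H)"
proof -
  have "C #> x \<in> rcosets H" if C: "C \<in> rcosets H" and x: "x \<in> carrier G" for C x
  proof -
    from C obtain g where g: "g \<in> carrier G" "C = H #> g"
      by (auto simp: RCOSETS_def)
    have "C #> x = H #> (g \<otimes> x)"
      using g x subgroup.subset[OF assms(2)] by (simp add: coset_mult_assoc)
    then show ?thesis
      using g x subgroup.subset[OF assms(2)] by (simp add: rcosetsI)
  qed
  then show ?thesis
    using sym_gens_closed[OF assms(1)] by (unfold_locales) (auto simp: coset_graph_def)
qed

end

theory Submission
  imports Defs
begin

text \<open>
  Let \<open>w\<close> be a vertex of a geodesic that starts at \<open>u \<in> A \<inter> B\<close>. The pairs of cosets \<open>(Aw', Bw')\<close>,
  for \<open>w'\<close> running along the geodesic from \<open>u\<close> to \<open>w\<close>, lie in the product of the two balls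
  of radius \<open>K\<close>, so they take at most \<open>M\<^sub>A M\<^sub>B\<close> values. Cutting out the loops of this walk in the
  product of the coset graphs leaves a word \<open>y\<close> of length less than \<open>M\<^sub>A M\<^sub>B\<close> with
  \<open>Ay = Aw\<close> and \<open>By = Bw\<close>; hence \<open>w y\<inverse> \<in> A \<inter> B\<close>, and \<open>w\<close> is within distance \<open>M\<^sub>A M\<^sub>B - 1\<close> of
  \<open>A \<inter> B\<close>. The remaining \<open>1\<close> accounts for interior points of edges.
\<close>

lemma cayley_graph_sel:
  "verts (cayley_graph G X) = carrier G"
  "arcs (cayley_graph G X) = carrier G \<times> sym_gens G X"
  "tail (cayley_graph G X) = fst"
  "head (cayley_graph G X) = (\<lambda>(g, x). g \<otimes>\<^bsub>G\<^esub> x)"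
  by (simp_all add: cayley_graph_def)

lemma coset_graph_sel:
  "verts (coset_graph G X H) = rcosets\<^bsub>G\<^esub> H"
  "arcs (coset_graph G X H) = (rcosets\<^bsub>G\<^esub> H) \<times> sym_gens G X"
  "tail (coset_graph G X H) = fst"
  "head (coset_graph G X H) = (\<lambda>(C, x). C #>\<^bsub>G\<^esub> x)"
  by (simp_all add: coset_graph_def)

text \<open>Pigeonhole on an automaton with transition function \<open>f\<close>: a shortest word
  with the required end state and all its states in \<open>S\<close> repeats no state. The bound is
  strict because a word of length n passes through n + 1 states, counting \<open>s\<close>.\<close>

lemma foldl_cut_loops:
  assumes "finite S" and "\<And>n. foldl f s (take n xs) \<in> S"
  shows "\<exists>ys. set ys \<subseteq> set xs \<and> foldl f s ys = foldl f s xs \<and> length ys < card S"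
proof -
  \<comment> \<open>Keeping all intermediate states in \<open>S\<close> is part of the property, so
    that the pigeonhole argument applies to the minimal word and not only to
    \<open>xs\<close>.\<close>
  define P where "P ys \<longleftrightarrow> set ys \<subseteq> set xs \<and> foldl f s ys = foldl f s xs \<and>
    (\<forall>n. foldl f s (take n ys) \<in> S)" for ys
  have "P xs"
    using assms(2) by (simp add: P_def)
  then obtain ys where ys: "P ys" and least: "\<And>zs. P zs \<Longrightarrow> length ys \<le> length zs"
    using ex_has_least_nat[of P xs length] by blast
  have "length ys < card S"
  proof (rule ccontr)
    assume "\<not> length ys < card S"
    moreover have "(\<lambda>n. foldl f s (take n ys)) ` {..length ys} \<subseteq> S"
      using ys by (auto simp: P_def)
    ultimately have "\<not> inj_on (\<lambda>n. foldl f s (take n ys)) {..length ys}"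
      using card_inj_on_le[OF _ _ assms(1)] by fastforce
    then obtain i j where ij: "i < j" "j \<le> length ys"
      and eq: "foldl f s (take i ys) = foldl f s (take j ys)"
      by (auto simp: inj_on_def) (metis linorder_neqE_nat)
    \<comment> \<open>Equal states at positions \<open>i\<close> and \<open>j\<close> bound a loop,
      which \<open>zs\<close> omits.\<close>
    define zs where "zs = take i ys @ drop j ys"
    have fold_zs: "foldl f s (take i ys @ us) = foldl f s (take j ys @ us)" for us
      using eq by simp
    have "foldl f s (take n zs) \<in> S" for n
    proof (cases "n \<le> i")
      case True
      then show ?thesis
        using ys ij by (simp add: zs_def P_def)
    next
      case False
      \<comment> \<open>Beyond the cut, \<open>zs\<close> runs through the states of
        \<open>ys\<close>, shifted by \<open>j - i\<close> positions.\<close>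
      then have "take n zs = take i ys @ take (n - i) (drop j ys)"
        using ij by (simp add: zs_def)
      then have "foldl f s (take n zs) = foldl f s (take j ys @ take (n - i) (drop j ys))"
        using fold_zs by simp
      also have "\<dots> = foldl f s (take (j + (n - i)) ys)"
        by (simp only: take_add)
      finally show ?thesis
        using ys by (simp add: P_def)
    qed
    moreover have "foldl f s zs = foldl f s ys"
      unfolding zs_def fold_zs by simp
    moreover have "set zs \<subseteq> set ys"
      by (auto simp: zs_def dest: in_set_takeD in_set_dropD)
    ultimately have "P zs"
      using ys by (auto simp: P_def)
    moreover have "length zs < length ys"
      using ij by (simp add: zs_def)
    ultimately show False
      using least by fastforce
  qed
  then show ?thesis
    using ys by (auto simp: P_def)
qed

section \<open>Walk lengths, distances and neighborhoods in a digraph\<close>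

context wf_digraph
begin

lemma awalk_cost_one: "awalk_cost (\<lambda>_. 1) p = real (length p)"
  by (induction p) auto

text \<open>\<open>path_dist\<close> is an infimum, but walk lengths are natural numbers, so it is
  attained as soon as some walk exists; without a walk it is infinite.\<close>

lemma path_dist_le_iff:
  "path_dist u v \<le> ereal R \<longleftrightarrow> (\<exists>p. awalk u p v \<and> real (length p) \<le> R)"
proof
  assume le: "path_dist u v \<le> ereal R"
  then have "u \<rightarrow>\<^sup>*\<^bsub>G\<^esub> v"
    using shortest_path_inf[of u v "\<lambda>_. 1"] by (cases "u \<rightarrow>\<^sup>*\<^bsub>G\<^esub> v") (auto simp: path_dist_def)
  then have "\<exists>q. awalk u q v"
    by (simp add: reachable_awalk)
  then obtain p where p: "awalk u p v" "\<And>q. awalk u q v \<Longrightarrow> length p \<le> length q"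
    using ex_has_least_nat[of "\<lambda>q. awalk u q v" _ length] by blast
  then have "ereal (real (length p)) \<le> path_dist u v"
    by (auto simp: path_dist_def \<mu>_def awalk_cost_one intro!: INF_greatest)
  then have "ereal (real (length p)) \<le> ereal R"
    using le by (rule order_trans)
  then show "\<exists>p. awalk u p v \<and> real (length p) \<le> R"
    using p(1) by auto
next
  assume "\<exists>p. awalk u p v \<and> real (length p) \<le> R"
  then obtain p where "awalk u p v" "real (length p) \<le> R"
    by blast
  then show "path_dist u v \<le> ereal R"
    using min_cost_le_walk_cost[of u p v "\<lambda>_. 1"]
    by (auto simp: path_dist_def awalk_cost_one intro: order_trans)
qed

text \<open>Serves the Cayley graph and the coset graphs alike, with \<open>l = snd\<close>: in
  each, the label of an arc acts on its tail by right multiplication.\<close>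

lemma awalk_end_foldl:
  assumes "awalk u p v" and "\<And>e. e \<in> arcs G \<Longrightarrow> head G e = f (tail G e) (l e)"
  shows "v = foldl f u (map l p)"
  using assms(1) by (induction p arbitrary: u) (auto simp: awalk_simps assms(2))

text \<open>A point of an arc is at most 1 away from the tail of that arc, and this tail is a vertex
  of the walk; hence the unit of slack in \<open>near\<close>.\<close>

lemma walk_in_nbhdI:
  assumes p: "awalk u p v"
    and near: "\<And>w. w \<in> set (awalk_verts u p) \<Longrightarrow> \<exists>s\<in>S. path_dist s w \<le> ereal (R - 1)"
  shows "walk_in_nbhd R S u p"
proof -
  have "w \<in> nbhd_verts R S" if w: "w \<in> set (awalk_verts u p)" for w
  proof -
    obtain s where s: "s \<in> S" "path_dist s w \<le> ereal (R - 1)"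
      using near[OF w] by blast
    then have "path_dist s w \<le> ereal R"
      using order_trans[of _ "ereal (R - 1)" "ereal R"] by simp
    moreover have "w \<in> verts G"
      using p w by auto
    ultimately show ?thesis
      using s(1) by (auto simp: nbhd_verts_def)
  qed
  moreover have "(a, t) \<in> nbhd_points R S" if a: "a \<in> set p" and t: "t \<in> {0..1}" for a t
  proof -
    obtain s where s: "s \<in> S" "path_dist s (tail G a) \<le> ereal (R - 1)"
      using near[OF awalk_verts_arc1[OF a]] by blast
    have "path_dist s (tail G a) + ereal t \<le> ereal (R - 1) + ereal 1"
      using s(2) t by (intro add_mono) auto
    then have "point_dist s (a, t) \<le> ereal R"
      by (simp add: point_dist_def min_le_iff_disj)
    then show ?thesis
      using s(1) a t p by (auto simp: nbhd_points_def)
  qed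
  ultimately show ?thesis
    by (auto simp: walk_in_nbhd_def)
qed

end

section \<open>Words in the generators, and the projection from the Cayley graph to a coset
  graph\<close>

context group
begin

lemma finite_sym_gens: "finite X \<Longrightarrow> finite (sym_gens G X)"
  by (simp add: sym_gens_def)

lemma foldl_mult_closed:
  assumes "u \<in> carrier G" and "set xs \<subseteq> carrier G"
  shows "foldl (\<otimes>) u xs \<in> carrier G"
  using assms by (induction xs arbitrary: u) auto

lemma foldl_mult_assoc:
  assumes "u \<in> carrier G" and "v \<in> carrier G" and "set xs \<subseteq> carrier G"
  shows "foldl (\<otimes>) (u \<otimes> v) xs = u \<otimes> foldl (\<otimes>) v xs"
  using assms by (induction xs arbitrary: v) (auto simp: m_assoc)

lemma foldl_r_coset:
  assumes "H \<subseteq> carrier G" and "u \<in> carrier G" and "set xs \<subseteq> carrier G"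
  shows "foldl (#>) (H #> u) xs = H #> foldl (\<otimes>) u xs"
  using assms by (induction xs arbitrary: u) (auto simp: coset_mult_assoc)

lemma cayley_awalk_foldl:
  assumes "X \<subseteq> carrier G" and "pre_digraph.awalk (cayley_graph G X) u p v"
  shows "v = foldl (\<otimes>) u (map snd p)"
proof -
  interpret C: wf_digraph "cayley_graph G X"
    by (rule wf_cayley_graph) fact
  show ?thesis
    by (rule C.awalk_end_foldl[OF assms(2)]) (auto simp: cayley_graph_sel)
qed

lemma cayley_awalk_labels:
  assumes "X \<subseteq> carrier G" and "pre_digraph.awalk (cayley_graph G X) u p v"
  shows "set (map snd p) \<subseteq> sym_gens G X"
proof -
  interpret C: wf_digraph "cayley_graph G X"
    by (rule wf_cayley_graph) fact
  have "set p \<subseteq> arcs (cayley_graph G X)"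
    using assms(2) by auto
  then show ?thesis
    by (auto simp: cayley_graph_sel)
qed

lemma cayley_awalk_of_word:
  assumes X: "X \<subseteq> carrier G" and "u \<in> carrier G" and "set xs \<subseteq> sym_gens G X"
  shows "\<exists>p. pre_digraph.awalk (cayley_graph G X) u p (foldl (\<otimes>) u xs) \<and> length p = length xs"
proof -
  interpret C: wf_digraph "cayley_graph G X"
    by (rule wf_cayley_graph) fact
  show ?thesis
    using assms(2,3)
  proof (induction xs arbitrary: u)
    case Nil
    then show ?case
      by (auto simp: C.awalk_Nil_iff cayley_graph_sel)
  next
    case (Cons x xs)
    then have "u \<otimes> x \<in> carrier G"
      using sym_gens_closed[OF X] by auto
    then obtain p where "C.awalk (u \<otimes> x) p (foldl (\<otimes>) (u \<otimes> x) xs)" "length p = length xs"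
      using Cons by fastforce
    then show ?case
      using Cons.prems
      by (intro exI[of _ "(u, x) # p"]) (auto simp: C.awalk_Cons_iff cayley_graph_sel)
  qed
qed

text \<open>The projection sending \<open>g\<close> to \<open>H #> g\<close> maps arcs to arcs with
  the same label, because \<open>(H #> g) #> x = H #> (g \<otimes> x)\<close>.\<close>

lemma coset_awalk_of_cayley_awalk:
  assumes X: "X \<subseteq> carrier G" and H: "subgroup H G"
    and "pre_digraph.awalk (cayley_graph G X) u p v"
  shows "pre_digraph.awalk (coset_graph G X H) (H #> u) (map (\<lambda>(g, x). (H #> g, x)) p) (H #> v)"
proof -
  interpret C: wf_digraph "cayley_graph G X"
    by (rule wf_cayley_graph) fact
  interpret D: wf_digraph "coset_graph G X H"
    by (rule wf_coset_graph) fact+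
  note closed = sym_gens_closed[OF X] and sub = subgroup.subset[OF H]
  show ?thesis
    using assms(3)
  proof (induction p arbitrary: u)
    case Nil
    then show ?case
      using sub
      by (auto simp: C.awalk_Nil_iff D.awalk_Nil_iff cayley_graph_sel coset_graph_sel rcosetsI)
  next
    case (Cons e p)
    obtain g x where e: "e = (g, x)"
      by (cases e)
    have gx: "g \<in> carrier G" "x \<in> sym_gens G X" "u = g" "C.awalk (g \<otimes> x) p v"
      using Cons.prems by (auto simp: e C.awalk_Cons_iff cayley_graph_sel)
    have "H #> g #> x = H #> (g \<otimes> x)"
      using gx closed sub by (intro coset_mult_assoc) auto
    then show ?case
      using Cons.IH[OF gx(4)] gx sub
      by (auto simp: e D.awalk_Cons_iff coset_graph_sel rcosetsI)
  qed
qed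

text \<open>The projection preserves walk lengths and sends all of \<open>H\<close> to the base
  vertex.\<close>

lemma coset_mem_nbhd_verts:
  assumes X: "X \<subseteq> carrier G" and H: "subgroup H G"
    and "w \<in> wf_digraph.nbhd_verts (cayley_graph G X) R H"
  shows "H #> w \<in> wf_digraph.nbhd_verts (coset_graph G X H) R {H #> \<one>}"
proof -
  interpret C: wf_digraph "cayley_graph G X"
    by (rule wf_cayley_graph) fact
  interpret D: wf_digraph "coset_graph G X H"
    by (rule wf_coset_graph) fact+
  obtain s p where s: "s \<in> H" "C.awalk s p w" "real (length p) \<le> R"
    using assms(3) by (auto simp: C.nbhd_verts_def C.path_dist_le_iff)
  have "H #> s = H #> \<one>"
    using s(1) H by (simp add: coset_join2 subgroup.mem_carrier subgroup.subset)
  then have "D.awalk (H #> \<one>) (map (\<lambda>(g, x). (H #> g, x)) p) (H #> w)"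
    using coset_awalk_of_cayley_awalk[OF X H s(2)] by simp
  moreover from this have "H #> w \<in> verts (coset_graph G X H)"
    by (rule D.awalk_last_in_verts)
  ultimately show ?thesis
    using s(3) by (auto simp: D.nbhd_verts_def D.path_dist_le_iff intro!: exI)
qed

text \<open>A vertex of the ball is determined by the labels of a walk leading to it from
  \<open>C\<close>, and only finitely many words have length at most \<open>R\<close>. This makes
  \<open>num_coset_nbhd\<close> a true count, as the pigeonhole argument requires.\<close>

lemma finite_coset_nbhd_verts:
  assumes "finite X" and X: "X \<subseteq> carrier G" and H: "subgroup H G"
  shows "finite (wf_digraph.nbhd_verts (coset_graph G X H) R {C})"
proof -
  interpret D: wf_digraph "coset_graph G X H"
    by (rule wf_coset_graph) fact+
  let ?W = "{xs. set xs \<subseteq> sym_gens G X \<and> length xs \<le> nat \<lfloor>R\<rfloor>}"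
  have "D.nbhd_verts R {C} \<subseteq> foldl (#>) C ` ?W"
  proof
    fix D assume "D \<in> D.nbhd_verts R {C}"
    then obtain p where p: "D.awalk C p D" "real (length p) \<le> R"
      by (auto simp: D.nbhd_verts_def D.path_dist_le_iff)
    have "D = foldl (#>) C (map snd p)"
      by (rule D.awalk_end_foldl[OF p(1)]) (auto simp: coset_graph_sel)
    moreover have "set p \<subseteq> arcs (coset_graph G X H)"
      using p(1) by auto
    then have "map snd p \<in> ?W"
      using p(2) by (auto simp: coset_graph_sel le_nat_floor)
    ultimately show "D \<in> foldl (#>) C ` ?W"
      by blast
  qed
  then show ?thesis
    using finite_lists_length_le[OF finite_sym_gens[OF assms(1)]] finite_surj by blast
qed

lemma mult_inv_mem_of_r_coset_eq:
  assumes "subgroup H G" and "w \<in> carrier G" and "y \<in> carrier G" and "H #> y = H #> w"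
  shows "w \<otimes> inv y \<in> H"
  using subgroup.rcos_module_imp[OF assms(1) is_group assms(3)] rcos_self[OF assms(2,1)] assms(4)
  by simp

text \<open>Treats one vertex at a time, with the bound already lowered by 1 as
  \<open>walk_in_nbhdI\<close> demands.\<close>

lemma quasiconvex_Int_vertex:
  assumes "finite X" and X: "X \<subseteq> carrier G"
    and A: "quasiconvex G X K A" and B: "quasiconvex G X K B"
    and u: "u \<in> A \<inter> B" and v: "v \<in> A \<inter> B"
    and p: "wf_digraph.geodesic (cayley_graph G X) u p v"
    and w: "w \<in> set (pre_digraph.awalk_verts (cayley_graph G X) u p)"
  shows "\<exists>s\<in>A \<inter> B. wf_digraph.path_dist (cayley_graph G X) s w
    \<le> ereal (real (num_coset_nbhd G X K A * num_coset_nbhd G X K B) - 1)"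
proof -
  interpret C: wf_digraph "cayley_graph G X"
    by (rule wf_cayley_graph) fact
  have sA: "subgroup A G" and sB: "subgroup B G"
    using A B by (auto simp: quasiconvex_def)
  note subA = subgroup.subset[OF sA] and subB = subgroup.subset[OF sB]
  define S where "S =
    wf_digraph.nbhd_verts (coset_graph G X A) K {A #> \<one>} \<times>
    wf_digraph.nbhd_verts (coset_graph G X B) K {B #> \<one>}"
  \<comment> \<open>One letter acts on both cosets at once, so that a single shortened word serves
    \<open>A\<close> and \<open>B\<close> together.\<close>
  define f where "f = (\<lambda>(C, D) x. (C #> x, D #> x))"
  have cardS: "card S = num_coset_nbhd G X K A * num_coset_nbhd G X K B"
    by (simp add: S_def num_coset_nbhd_def card_cartesian_product)
  have finS: "finite S"
    unfolding S_def using finite_coset_nbhd_verts[OF assms(1) X] sA sB by blast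
  have awalk_p: "C.awalk u p v"
    using p by (simp add: C.geodesic_def)
  obtain q r where pqr: "p = q @ r" and q: "C.awalk u q w"
    using C.awalk_decomp[OF awalk_p w] by blast
  have uG: "u \<in> carrier G" and wG: "w \<in> carrier G"
    using C.awalk_hd_in_verts[OF q] C.awalk_last_in_verts[OF q] by (auto simp: cayley_graph_sel)
  have foldl_f_pair: "foldl f (C, D) xs = (foldl (#>) C xs, foldl (#>) D xs)" for C D xs
    by (induction xs arbitrary: C D) (auto simp: f_def)
  \<comment> \<open>The start \<open>(A, B)\<close> is the pair of cosets of every \<open>g\<close>
    in the intersection. This is used with \<open>g = u\<close> for the word along the geodesic and
    with \<open>g = \<one>\<close> for the shortened word.\<close>
  have foldl_f: "foldl f (A, B) xs = (A #> foldl (\<otimes>) g xs, B #> foldl (\<otimes>) g xs)"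
    if "g \<in> A \<inter> B" "set xs \<subseteq> carrier G" for g xs
  proof -
    have g: "g \<in> carrier G" "A #> g = A" "B #> g = B"
      using that(1) subA coset_join2[OF _ sA] coset_join2[OF _ sB] by auto
    show ?thesis
      using foldl_r_coset[OF subA g(1) that(2)] foldl_r_coset[OF subB g(1) that(2)]
      by (simp add: foldl_f_pair g(2,3))
  qed
  define xs where "xs = map snd q"
  have xs_gens: "set xs \<subseteq> sym_gens G X"
    unfolding xs_def by (rule cayley_awalk_labels[OF X q])
  then have xsG: "set xs \<subseteq> carrier G"
    using sym_gens_closed[OF X] by blast
  \<comment> \<open>Read from \<open>u\<close>, each prefix of \<open>xs\<close> ends at a vertex of
    the geodesic. Quasiconvexity puts this vertex within \<open>K\<close> of both subgroups, and
    projecting gives a pair in \<open>S\<close>.\<close>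
  have "foldl f (A, B) (take n xs) \<in> S" for n
  proof -
    define w' where "w' = foldl (\<otimes>) u (take n xs)"
    have split: "p = take n q @ drop n q @ r"
      using pqr by (metis append_assoc append_take_drop_id)
    then have "C.awalk u (take n q @ drop n q @ r) v"
      using awalk_p by (simp only: split)
    then obtain z where z: "C.awalk u (take n q) z" "C.awalk z (drop n q @ r) v"
      using C.awalk_append_iff by blast
    have "z = w'"
      using cayley_awalk_foldl[OF X z(1)] by (simp add: w'_def xs_def take_map)
    moreover have "z \<in> set (C.awalk_verts u (take n q @ drop n q @ r))"
      using z C.set_awalk_verts_append C.hd_in_awalk_verts(1) by blast
    ultimately have "w' \<in> set (C.awalk_verts u p)"
      by (simp only: split)
    moreover have "C.walk_in_nbhd K A u p" "C.walk_in_nbhd K B u p"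
      using A B u v p by (auto simp: quasiconvex_def)
    ultimately have "w' \<in> C.nbhd_verts K A" "w' \<in> C.nbhd_verts K B"
      by (auto simp: C.walk_in_nbhd_def)
    moreover have "set (take n xs) \<subseteq> carrier G"
      using xsG by (auto dest: in_set_takeD)
    ultimately show ?thesis
      using coset_mem_nbhd_verts[OF X] sA sB u
      by (simp add: foldl_f S_def flip: w'_def)
  qed
  then obtain ys where ys: "set ys \<subseteq> set xs" "foldl f (A, B) ys = foldl f (A, B) xs"
      "length ys < card S"
    using foldl_cut_loops[OF finS] by blast
  define y where "y = foldl (\<otimes>) \<one> ys"
  have ysG: "set ys \<subseteq> carrier G"
    using ys(1) xsG by blast
  then have yG: "y \<in> carrier G"
    by (simp add: y_def foldl_mult_closed)
  have "\<one> \<in> A \<inter> B"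
    using sA sB by (simp add: subgroup.one_closed)
  then have "foldl f (A, B) ys = (A #> y, B #> y)"
    using foldl_f[OF _ ysG] by (simp add: y_def)
  moreover have "foldl f (A, B) xs = (A #> w, B #> w)"
    using foldl_f[OF u xsG] cayley_awalk_foldl[OF X q] by (simp add: xs_def)
  ultimately have "A #> y = A #> w" "B #> y = B #> w"
    using ys(2) by auto
  then have s: "w \<otimes> inv y \<in> A \<inter> B"
    using mult_inv_mem_of_r_coset_eq wG yG sA sB by blast
  \<comment> \<open>Since \<open>w = (w \<otimes> inv y) \<otimes> y\<close>, the word
    \<open>ys\<close> labels a walk to \<open>w\<close> from a point of the intersection; its
    letters occur in \<open>xs\<close>, so they are generators.\<close>
  have "w = foldl (\<otimes>) (w \<otimes> inv y) ys"
    using foldl_mult_assoc[of "w \<otimes> inv y" \<one> ys] wG yG ysG by (simp add: m_assoc flip: y_def)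
  moreover have "w \<otimes> inv y \<in> carrier G"
    using wG yG by simp
  moreover have "set ys \<subseteq> sym_gens G X"
    using ys(1) xs_gens by blast
  ultimately obtain p' where "C.awalk (w \<otimes> inv y) p' w" "length p' = length ys"
    using cayley_awalk_of_word[OF X] by metis
  \<comment> \<open>The strict inequality between natural numbers yields the \<open>- 1\<close> over
    the reals.\<close>
  moreover have "real (length ys) \<le> real (card S) - 1"
    using ys(3) by linarith
  ultimately have "C.path_dist (w \<otimes> inv y) w \<le> ereal (real (card S) - 1)"
    using C.path_dist_le_iff by auto
  then show ?thesis
    using s by (auto simp: cardS)
qed

end

theorem lemma5:
  fixes G :: "('a, 'm) monoid_scheme" and X A B :: "'a set" and K :: real
  assumes "group G"
    and "finite X" and "X \<subseteq> carrier G" and "generate G (sym_gens G X) = carrier G"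
    and "quasiconvex G X K A" and "quasiconvex G X K B"
  defines "M\<^sub>A \<equiv> num_coset_nbhd G X K A"
    and "M\<^sub>B \<equiv> num_coset_nbhd G X K B"
  shows "quasiconvex G X (real (M\<^sub>A * M\<^sub>B)) (A \<inter> B)"
proof -
  interpret group G by fact
  interpret C: wf_digraph "cayley_graph G X"
    by (rule wf_cayley_graph) fact
  have "subgroup (A \<inter> B) G"
    using assms(5,6) by (intro subgroups_Inter_pair) (auto simp: quasiconvex_def)
  moreover have "C.walk_in_nbhd (real (M\<^sub>A * M\<^sub>B)) (A \<inter> B) u p"
    if "u \<in> A \<inter> B" "v \<in> A \<inter> B" "C.geodesic u p v" for u v p
  proof (rule C.walk_in_nbhdI)
    show "C.awalk u p v"
      using that(3) by (simp add: C.geodesic_def)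
    show "\<exists>s\<in>A \<inter> B. C.path_dist s w \<le> ereal (real (M\<^sub>A * M\<^sub>B) - 1)"
      if "w \<in> set (C.awalk_verts u p)" for w
      unfolding M\<^sub>A_def M\<^sub>B_def
      using \<open>u \<in> A \<inter> B\<close> \<open>v \<in> A \<inter> B\<close> \<open>C.geodesic u p v\<close> that
      by (rule quasiconvex_Int_vertex[OF assms(2,3,5,6)])
  qed
  ultimately show ?thesis
    by (auto simp: quasiconvex_def)
qed

end
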